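(* Any four generic tuples $(v_i,w_i)=(u_i',u_i'')$, $i=1,2,3,4$, at a point $(x,u)$, of the higher Cauchy data plane $\mathbb{C}^2(u',u'')$, determine an equation of first rank $$u''=Du'^3+Cu'^2+Bu'+A$$ (i.e. values of $A,B,C,D$ at the point for which the four tuples satisfy the equation); hence the four corresponding centres of curvature determine a cubic of the type $$E(x_0^2+y_0^2)=-Dx_0^3+Cx_0^2y_0-Bx_0y_0^2+Ay_0^3$$ on which they lie.
   Context: The higher Cauchy data plane $\mathbb{C}^2(u',u'')$ is the plane of pairs $(u',u'')$ (second-order jets) above a given fixed point $(x,u)\in\mathbb{C}^2$. To a pair $(v,w)=(u',u'')$ with $w\neq0$ corresponds the centre of curvature $$x_0=-\frac{v(1+v^2)}{w},\qquad y_0=\frac{1+v^2}{w}.$$ Generic means: $v_i\neq v_j$ for $i\neq j$, and $w_i\neq0$, $1+v_i^2\neq0$ for all $i$ (so that the centres are defined and are not at the origin). *)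

theory Defs
  imports Complex_Main
begin

text \<open>Everything takes place above one fixed base point \<open>(x, u)\<close>: a tuple \<open>(v, w)\<close> stands for
  \<open>(u', u'')\<close> there, \<open>A, B, C, D\<close> are the values of the coefficients at \<open>(x, u)\<close>, and
  \<open>(x, u)\<close> is the origin of the coordinates \<open>x\<^sub>0, y\<^sub>0\<close> of the centres of curvature.\<close>

type_synonym cauchy_data = "complex \<times> complex"

definition first_rank_equation ::
  "complex \<Rightarrow> complex \<Rightarrow> complex \<Rightarrow> complex \<Rightarrow> cauchy_data set" where
  "first_rank_equation D C B A = {(v, w). w = D * v^3 + C * v^2 + B * v + A}"

text \<open>Only meaningful for \<open>w \<noteq> 0\<close>.\<close>

definition centre_of_curvature :: "cauchy_data \<Rightarrow> complex \<times> complex" where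
  "centre_of_curvature = (\<lambda>(v, w). (- (v * (1 + v^2)) / w, (1 + v^2) / w))"

definition generic_tuples :: "'i set \<Rightarrow> ('i \<Rightarrow> complex) \<Rightarrow> ('i \<Rightarrow> complex) \<Rightarrow> bool" where
  "generic_tuples I v w \<longleftrightarrow>
     (\<forall>i\<in>I. \<forall>j\<in>I. i \<noteq> j \<longrightarrow> v i \<noteq> v j) \<and> (\<forall>i\<in>I. w i \<noteq> 0 \<and> 1 + (v i)^2 \<noteq> 0)"

definition centre_cubic ::
  "complex \<Rightarrow> complex \<Rightarrow> complex \<Rightarrow> complex \<Rightarrow> complex \<Rightarrow> (complex \<times> complex) set" where
  "centre_cubic E D C B A =
     {(x0, y0). E * (x0^2 + y0^2) = - D * x0^3 + C * x0^2 * y0 - B * x0 * y0^2 + A * y0^3}"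

end

theory Submission
  imports Defs "HOL-Computational_Algebra.Polynomial"
begin

text \<open>With \<open>k = (1 + v\<^sup>2) / w\<close> the centre of curvature is \<open>(- k v, k)\<close>, and both sides of the cubic
  become \<open>k\<^sup>3\<close> times a side of \<open>E w = D v\<^sup>3 + C v\<^sup>2 + B v + A\<close>. Everything thus reduces to existence
  and uniqueness of the polynomial of degree at most three through four points with distinct
  abscissae.\<close>

text \<open>Lagrange interpolation: \<open>l i\<close> has \<open>card I - 1\<close> linear factors
  and vanishes at every node except \<open>v i\<close>, so dividing by its value there and weighting
  by \<open>w i\<close> gives a summand that affects the value at that node only.\<close>

lemma interpolation_poly_exists:
  fixes v w :: "'i \<Rightarrow> 'a::field"
  assumes "finite I" "inj_on v I"
  obtains p where "degree p \<le> card I - 1" "\<And>i. i \<in> I \<Longrightarrow> poly p (v i) = w i"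
proof
  define l where "l i = (\<Prod>j\<in>I - {i}. [:- v j, 1:])" for i
  define p where "p = (\<Sum>i\<in>I. smult (w i / poly (l i) (v i)) (l i))"
  show "degree p \<le> card I - 1"
    unfolding p_def
  proof (rule degree_sum_le)
    fix i assume "i \<in> I"
    have "degree (l i) \<le> (\<Sum>j\<in>I - {i}. degree [:- v j, 1:])"
      unfolding l_def using assms(1) degree_prod_sum_le[of "I - {i}" "\<lambda>j. [:- v j, 1:]"]
      by (simp add: o_def)
    also have "\<dots> = card I - 1"
      using \<open>i \<in> I\<close> by simp
    finally show "degree (smult (w i / poly (l i) (v i)) (l i)) \<le> card I - 1"
      using degree_smult_le order_trans by blast
  qed (use assms in auto)
  fix i assume i: "i \<in> I"
  have zero: "poly (l j) (v i) = 0" if "j \<in> I - {i}" for j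
    using assms(1) i that by (auto simp: l_def poly_prod)
  \<comment> \<open>Each factor contributes \<open>v i - v j\<close> with
    \<open>j \<noteq> i\<close>, which is nonzero by injectivity.\<close>
  have nz: "poly (l i) (v i) \<noteq> 0"
    using assms i by (auto simp: l_def poly_prod dest: inj_onD)
  have "poly p (v i) = (\<Sum>j\<in>I. w j / poly (l j) (v j) * poly (l j) (v i))"
    by (simp add: p_def poly_sum)
  also have "\<dots> = w i"
    using assms(1) i zero nz by (simp add: sum.remove)
  finally show "poly p (v i) = w i" .
qed

text \<open>Four nodes allow degree at most 3, so the four unknowns are the coefficients of the
  interpolation polynomial.\<close>

lemma cubic_interpolation_exists:
  fixes v w :: "'i \<Rightarrow> 'a::field"
  assumes "card I = 4" "inj_on v I"
  obtains D C B A where "\<forall>i\<in>I. w i = D * v i ^ 3 + C * v i ^ 2 + B * v i + A"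
proof -
  have "finite I"
    using assms(1) card.infinite by fastforce
  then obtain p where p: "degree p \<le> 3" "\<And>i. i \<in> I \<Longrightarrow> poly p (v i) = w i"
    using interpolation_poly_exists[of I v w] assms by auto
  have "p = [:coeff p 0, coeff p 1, coeff p 2, coeff p 3:]" (is "_ = ?q")
  proof (rule poly_eqI)
    fix n
    \<comment> \<open>In the last case \<open>n\<close> exceeds 3, so both coefficients vanish by
      the degree bounds.\<close>
    consider "n = 0" | "n = 1" | "n = 2" | "n = 3" | m where "n = Suc (Suc (Suc (Suc m)))"
      by (metis One_nat_def Suc_1 numeral_3_eq_3 not0_implies_Suc)
    then show "coeff p n = coeff ?q n"
      using p(1) by cases (simp_all add: coeff_pCons numeral_eq_Suc coeff_eq_0)
  qed
  then have "poly p x = poly [:coeff p 0, coeff p 1, coeff p 2, coeff p 3:] x" for x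
    by simp
  then have "poly p x = coeff p 3 * x ^ 3 + coeff p 2 * x ^ 2 + coeff p 1 * x + coeff p 0" for x
    by (simp add: algebra_simps power2_eq_square power3_eq_cube)
  then show thesis
    using p(2) that by metis
qed

text \<open>Two polynomials of degree at most 3 that agree at four distinct points coincide;
  injectivity of \<open>v\<close> provides the four points.\<close>

lemma cubic_interpolation_unique:
  fixes v :: "'i \<Rightarrow> 'a::idom"
  assumes "card I = 4" "inj_on v I"
    and "\<And>i. i \<in> I \<Longrightarrow> D * v i ^ 3 + C * v i ^ 2 + B * v i + A =
                          D' * v i ^ 3 + C' * v i ^ 2 + B' * v i + A'"
  shows "D = D' \<and> C = C' \<and> B = B' \<and> A = A'"
proof -
  have "[:A, B, C, D:] = [:A', B', C', D':]"
  proof (rule poly_eqI_degree)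
    fix x assume "x \<in> v ` I"
    then show "poly [:A, B, C, D:] x = poly [:A', B', C', D':] x"
      using assms(3) by (auto simp: algebra_simps power2_eq_square power3_eq_cube)
  qed (use assms in \<open>auto simp: card_image\<close>)
  then show ?thesis
    by simp
qed

text \<open>The common factor \<open>k^3\<close> can be cancelled because
  \<open>1 + v^2 \<noteq> 0\<close>. Keeping \<open>E\<close> arbitrary serves both the cubic with
  \<open>E = 1\<close> and the classification of all cubics of this type through the
  centres.\<close>

lemma centre_of_curvature_in_centre_cubic_iff:
  assumes "w \<noteq> 0" "1 + v^2 \<noteq> 0"
  shows "centre_of_curvature (v, w) \<in> centre_cubic E D C B A \<longleftrightarrow>
    E * w = D * v^3 + C * v^2 + B * v + A"
proof -
  define k where "k = (1 + v^2) / w"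
  have k: "k \<noteq> 0" "1 + v^2 = k * w"
    using assms by (auto simp: k_def)
  have "centre_of_curvature (v, w) = (- (v * k), k)"
    by (simp add: centre_of_curvature_def k_def)
  moreover have "E * ((- (v * k))^2 + k^2) = k^3 * (E * w)"
  proof -
    \<comment> \<open>Only two factors \<open>k\<close> appear here; the third comes from
      \<open>1 + v^2 = k * w\<close>.\<close>
    have "E * ((- (v * k))^2 + k^2) = E * k^2 * (1 + v^2)"
      by algebra
    then show ?thesis
      unfolding k(2) by algebra
  qed
  moreover have "- D * (- (v * k))^3 + C * (- (v * k))^2 * k - B * (- (v * k)) * k^2 + A * k^3 =
      k^3 * (D * v^3 + C * v^2 + B * v + A)"
    by algebra
  ultimately have "centre_of_curvature (v, w) \<in> centre_cubic E D C B A \<longleftrightarrow>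
      k^3 * (E * w) = k^3 * (D * v^3 + C * v^2 + B * v + A)"
    unfolding centre_cubic_def by (simp only: mem_Collect_eq prod.case)
  then show ?thesis
    using k(1) by simp
qed

theorem proposition3p7:
  fixes v w :: "nat \<Rightarrow> complex"
  assumes "generic_tuples {1..4} v w"
  shows "(\<exists>!(D, C, B, A). \<forall>i\<in>{1..4}. (v i, w i) \<in> first_rank_equation D C B A) \<and>
    (\<forall>D C B A. (\<forall>i\<in>{1..4}. (v i, w i) \<in> first_rank_equation D C B A) \<longrightarrow>
       (D, C, B, A) \<noteq> (0, 0, 0, 0) \<and>
       (\<forall>i\<in>{1..4}. centre_of_curvature (v i, w i) \<in> centre_cubic 1 D C B A) \<and>
       (\<forall>E' D' C' B' A'.
          (\<forall>i\<in>{1..4}. centre_of_curvature (v i, w i) \<in> centre_cubic E' D' C' B' A') \<longleftrightarrow>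
          (\<exists>t. (E', D', C', B', A') = (t, t * D, t * C, t * B, t * A))))"
proof -
  let ?I = "{1..4} :: nat set"
  have I: "card ?I = 4" "inj_on v ?I"
    and nz: "\<And>i. i \<in> ?I \<Longrightarrow> w i \<noteq> 0" "\<And>i. i \<in> ?I \<Longrightarrow> 1 + v i ^ 2 \<noteq> 0"
    using assms by (auto simp: generic_tuples_def inj_on_def)
  have eq_iff: "(\<forall>i\<in>?I. (v i, w i) \<in> first_rank_equation D C B A) \<longleftrightarrow>
      (\<forall>i\<in>?I. w i = D * v i ^ 3 + C * v i ^ 2 + B * v i + A)" for D C B A
    by (simp add: first_rank_equation_def)
  have centre_iff: "(\<forall>i\<in>?I. centre_of_curvature (v i, w i) \<in> centre_cubic E D C B A) \<longleftrightarrow>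
      (\<forall>i\<in>?I. E * w i = D * v i ^ 3 + C * v i ^ 2 + B * v i + A)" for E D C B A
    using nz by (intro ball_cong refl centre_of_curvature_in_centre_cubic_iff) auto
  obtain D0 C0 B0 A0
    where ex: "\<forall>i\<in>?I. w i = D0 * v i ^ 3 + C0 * v i ^ 2 + B0 * v i + A0"
    using cubic_interpolation_exists[OF I] by blast
  have unique: "D = D0 \<and> C = C0 \<and> B = B0 \<and> A = A0"
    if "\<forall>i\<in>?I. w i = D * v i ^ 3 + C * v i ^ 2 + B * v i + A" for D C B A
    using that ex by (intro cubic_interpolation_unique[OF I]) metis
  show ?thesis
    \<comment> \<open>From here on, only cubic interpolation at the nodes \<open>v i\<close> is
      involved.\<close>
    unfolding eq_iff centre_iff
  proof (intro conjI allI impI)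
    show "\<exists>!(D, C, B, A). \<forall>i\<in>?I. w i = D * v i ^ 3 + C * v i ^ 2 + B * v i + A"
    proof (rule ex1I[of _ "(D0, C0, B0, A0)"])
      show "case (D0, C0, B0, A0) of (D, C, B, A) \<Rightarrow>
          \<forall>i\<in>?I. w i = D * v i ^ 3 + C * v i ^ 2 + B * v i + A"
        using ex by simp
      fix q :: "complex \<times> complex \<times> complex \<times> complex"
      assume "case q of (D, C, B, A) \<Rightarrow>
          \<forall>i\<in>?I. w i = D * v i ^ 3 + C * v i ^ 2 + B * v i + A"
      then show "q = (D0, C0, B0, A0)"
        using unique by (cases q) (simp only: prod.case prod.inject)
    qed
  next
    fix D C B A
    assume eq: "\<forall>i\<in>?I. w i = D * v i ^ 3 + C * v i ^ 2 + B * v i + A"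
    show "(D, C, B, A) \<noteq> (0, 0, 0, 0)"
    proof
      assume "(D, C, B, A) = (0, 0, 0, 0)"
      \<comment> \<open>Zero coefficients would make every \<open>w i\<close> vanish; one index
        suffices for the contradiction.\<close>
      then have "w 1 = 0"
        using bspec[OF eq, of 1] by simp
      then show False
        using nz(1)[of 1] by simp
    qed
    show "\<forall>i\<in>?I. 1 * w i = D * v i ^ 3 + C * v i ^ 2 + B * v i + A"
      using eq by simp
    fix E' D' C' B' A'
    \<comment> \<open>For fixed \<open>E'\<close>, the data \<open>E' * w i\<close> are interpolated
      by \<open>E'\<close> times the original cubic polynomial, and by no other. The scaling
      parameter \<open>t\<close> is therefore \<open>E'\<close> itself; in particular
      \<open>E' = 0\<close> leaves only the zero equation.\<close>
    have "(\<forall>i\<in>?I. E' * w i = D' * v i ^ 3 + C' * v i ^ 2 + B' * v i + A') \<longleftrightarrow>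
        D' = E' * D \<and> C' = E' * C \<and> B' = E' * B \<and> A' = E' * A" (is "?L \<longleftrightarrow> ?R")
    proof
      assume L: ?L
      have scaled: "E' * w i = E' * D * v i ^ 3 + E' * C * v i ^ 2 + E' * B * v i + E' * A"
        if "i \<in> ?I" for i
        using bspec[OF eq that] by (simp add: algebra_simps)
      show ?R
        using L scaled by (intro cubic_interpolation_unique[OF I]) metis
    next
      assume ?R
      then show ?L
        using eq by (simp add: algebra_simps)
    qed
    then show "(\<forall>i\<in>?I. E' * w i = D' * v i ^ 3 + C' * v i ^ 2 + B' * v i + A') \<longleftrightarrow>
        (\<exists>t. (E', D', C', B', A') = (t, t * D, t * C, t * B, t * A))"
      by auto
  qed
qed

end
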